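(* A DR-net $\pi$ is in $\mathbf{L^3}$ iff all cycles in its $\mathbin{⅋}$-closure $\pi_0$ are $!?$-balanced.
   Context: Nets are built from links axiom, cut, one, bottom, tensor, par (conclusion $A\mathbin{⅋}B$), flat (premise $A$, conclusion $\flat A$), pax, why not (premises $\flat A$, conclusion $?A$), of course (premise $A$, conclusion $!A$), paragraph (premise $A$, conclusion $\S A$), with boxes (of course principal port, pax auxiliary ports). A switching keeps exactly one premise of each par and why not link and collapses depth-zero boxes to nodes; a net is DR-correct if all switchings are acyclic and so are (recursively) the contents of boxes; a DR-net is a DR-correct net with no $\flat$-formula among its conclusions. An exponential indexing of a net is a function $I$ from edges to $\mathbb Z$ such that both conclusions of an axiom and both premises of a cut have equal index; premises and conclusion of one, bottom, tensor, par, flat and pax links have equal index; for paragraph, of course and why not links, all premises have index $I(e')+1$ where $e'$ is the conclusion; and all conclusions of the net have the same index. $\mathbf{L^3}$ (linear logic by levels) is the set of DR-nets admitting an exponential indexing. The $\mathbin{⅋}$-closure of a net with conclusions $A_1,\ldots,A_n$ is obtained by adding a tree of par links producing the single conclusion $A_1\mathbin{⅋}\cdots\mathbin{⅋}A_n$. A cycle (in the underlying undirected graph) is $!?$-balanced if it traverses paragraph, of course and why not links from premise to conclusion as many times as from conclusion to premise. *)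

theory Defs
  imports "Graph_Theory.Arc_Walk"
begin

section \<open>Formulas\<close>

datatype 'v fm =
    Atom 'v
  | NAtom 'v
  | One
  | Bottom
  | Tensor "'v fm" "'v fm"
  | Par "'v fm" "'v fm"
  | OfCourse "'v fm"
  | WhyNot "'v fm"
  | Paragraph "'v fm"

primrec dual :: "'v fm \<Rightarrow> 'v fm" where
  "dual (Atom x) = NAtom x"
| "dual (NAtom x) = Atom x"
| "dual One = Bottom"
| "dual Bottom = One"
| "dual (Tensor A B) = Par (dual A) (dual B)"
| "dual (Par A B) = Tensor (dual A) (dual B)"
| "dual (OfCourse A) = WhyNot (dual A)"
| "dual (WhyNot A) = OfCourse (dual A)"
| "dual (Paragraph A) = Paragraph (dual A)"

text \<open>Edges carry either a formula or a \<open>\<flat>\<close>-formula; \<open>\<flat>\<close> is not a connective and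
  cannot occur inside a formula.\<close>

datatype 'v edge_label = Formula "'v fm" | Flat "'v fm"


section \<open>Nets\<close>

datatype link_kind =
    Ax_link | Cut_link | One_link | Bottom_link | Tensor_link | Par_link
  | Flat_link | Pax_link | WhyNot_link | OfCourse_link | Paragraph_link

text \<open>\<open>link_typing k \<Gamma> \<Delta>\<close>: a link of kind \<open>k\<close> may have premises labelled \<open>\<Gamma>\<close> and conclusions
  labelled \<open>\<Delta>\<close>. A why not link has any number of premises, including none (weakening).\<close>

inductive link_typing :: "link_kind \<Rightarrow> 'v edge_label list \<Rightarrow> 'v edge_label list \<Rightarrow> bool" where
  "link_typing Ax_link [] [Formula A, Formula (dual A)]"
| "link_typing Cut_link [Formula A, Formula (dual A)] []"
| "link_typing One_link [] [Formula One]"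
| "link_typing Bottom_link [] [Formula Bottom]"
| "link_typing Tensor_link [Formula A, Formula B] [Formula (Tensor A B)]"
| "link_typing Par_link [Formula A, Formula B] [Formula (Par A B)]"
| "link_typing Flat_link [Formula A] [Flat A]"
| "link_typing Pax_link [Flat A] [Flat A]"
| "link_typing WhyNot_link (replicate n (Flat A)) [Formula (WhyNot A)]"
| "link_typing OfCourse_link [Formula A] [Formula (OfCourse A)]"
| "link_typing Paragraph_link [Formula A] [Formula (Paragraph A)]"

text \<open>The border of a box (its ports) is not part of its content.\<close>

record 'l box =
  principal :: 'l
  auxiliary :: "'l set"
  content :: "'l set"

definition ports :: "'l box \<Rightarrow> 'l set" where
  "ports b = insert (principal b) (auxiliary b)"

definition box_links :: "'l box \<Rightarrow> 'l set" where
  "box_links b = ports b \<union> content b"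

text \<open>Only the values of \<open>kind\<close>, \<open>prems\<close>, \<open>concls\<close> on \<open>links\<close>, and those of \<open>label\<close> on the
  edges of the net, are meaningful.\<close>

record ('v, 'l, 'e) net =
  links :: "'l set"
  kind :: "'l \<Rightarrow> link_kind"
  prems :: "'l \<Rightarrow> 'e list"
  concls :: "'l \<Rightarrow> 'e list"
  label :: "'e \<Rightarrow> 'v edge_label"
  boxes :: "'l box set"

text \<open>Every edge is the conclusion of some link.\<close>

definition edges :: "('v, 'l, 'e) net \<Rightarrow> 'e set" where
  "edges \<pi> = (\<Union>l\<in>links \<pi>. set (concls \<pi> l))"

definition conclusions :: "('v, 'l, 'e) net \<Rightarrow> 'e set" where
  "conclusions \<pi> = edges \<pi> - (\<Union>l\<in>links \<pi>. set (prems \<pi> l))"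

definition source :: "('v, 'l, 'e) net \<Rightarrow> 'e \<Rightarrow> 'l" where
  "source \<pi> e = (THE l. l \<in> links \<pi> \<and> e \<in> set (concls \<pi> l))"

text \<open>Meaningful only for edges that are not conclusions of the net.\<close>

definition target :: "('v, 'l, 'e) net \<Rightarrow> 'e \<Rightarrow> 'l" where
  "target \<pi> e = (THE l. l \<in> links \<pi> \<and> e \<in> set (prems \<pi> l))"

definition content_net :: "('v, 'l, 'e) net \<Rightarrow> 'l box \<Rightarrow> ('v, 'l, 'e) net" where
  "content_net \<pi> b =
     \<pi>\<lparr>links := content b, boxes := {b' \<in> boxes \<pi>. box_links b' \<subseteq> content b}\<rparr>"

definition graph_wf :: "('v, 'l, 'e) net \<Rightarrow> bool" where
  "graph_wf \<pi> \<longleftrightarrow>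
     finite (links \<pi>) \<and>
     (\<forall>l\<in>links \<pi>.
        link_typing (kind \<pi> l) (map (label \<pi>) (prems \<pi> l)) (map (label \<pi>) (concls \<pi> l)) \<and>
        distinct (prems \<pi> l) \<and> distinct (concls \<pi> l) \<and> set (prems \<pi> l) \<subseteq> edges \<pi>) \<and>
     (\<forall>l\<in>links \<pi>. \<forall>l'\<in>links \<pi>. l \<noteq> l' \<longrightarrow>
        set (prems \<pi> l) \<inter> set (prems \<pi> l') = {} \<and>
        set (concls \<pi> l) \<inter> set (concls \<pi> l') = {})"

definition boxes_wf :: "('v, 'l, 'e) net \<Rightarrow> bool" where
  "boxes_wf \<pi> \<longleftrightarrow>
     (\<forall>b\<in>boxes \<pi>.
        box_links b \<subseteq> links \<pi> \<and> ports b \<inter> content b = {} \<and>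
        kind \<pi> (principal b) = OfCourse_link \<and>
        (\<forall>l\<in>auxiliary b. kind \<pi> l = Pax_link) \<and>
        graph_wf (content_net \<pi> b) \<and>
        conclusions (content_net \<pi> b) = (\<Union>l\<in>ports b. set (prems \<pi> l))) \<and>
     (\<forall>l\<in>links \<pi>. kind \<pi> l = OfCourse_link \<longrightarrow> (\<exists>!b. b \<in> boxes \<pi> \<and> principal b = l)) \<and>
     (\<forall>l\<in>links \<pi>. kind \<pi> l = Pax_link \<longrightarrow> (\<exists>!b. b \<in> boxes \<pi> \<and> l \<in> auxiliary b)) \<and>
     (\<forall>b\<in>boxes \<pi>. \<forall>b'\<in>boxes \<pi>. b \<noteq> b' \<longrightarrow>
        box_links b \<inter> box_links b' = {} \<or>
        box_links b \<subseteq> content b' \<or> box_links b' \<subseteq> content b)"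

definition is_net :: "('v, 'l, 'e) net \<Rightarrow> bool" where
  "is_net \<pi> \<longleftrightarrow> graph_wf \<pi> \<and> boxes_wf \<pi>"


section \<open>Undirected multigraphs and their cycles\<close>

text \<open>An undirected multigraph is represented by the symmetric digraph having, for each edge,
  one arc per direction of traversal; \<open>Down\<close> follows the orientation of the edge. Requiring the
  underlying edges of a cycle to be distinct rules out going back and forth along one edge, while
  loops and pairs of parallel edges are cycles.\<close>

datatype direction = Down | Up

definition undirected ::
  "'n set \<Rightarrow> 'e set \<Rightarrow> ('e \<Rightarrow> 'n) \<Rightarrow> ('e \<Rightarrow> 'n) \<Rightarrow> ('n, 'e \<times> direction) pre_digraph" where
  "undirected V E s t =
     \<lparr>verts = V,
      arcs = E \<times> UNIV,
      tail = (\<lambda>(e, d). case d of Down \<Rightarrow> s e | Up \<Rightarrow> t e),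
      head = (\<lambda>(e, d). case d of Down \<Rightarrow> t e | Up \<Rightarrow> s e)\<rparr>"

definition undirected_cycle ::
  "('n, 'e \<times> direction) pre_digraph \<Rightarrow> ('e \<times> direction) list \<Rightarrow> bool" where
  "undirected_cycle G c \<longleftrightarrow> pre_digraph.cycle G c \<and> distinct (map fst c)"


section \<open>Switchings and correctness\<close>

definition depth :: "('v, 'l, 'e) net \<Rightarrow> 'l \<Rightarrow> nat" where
  "depth \<pi> l = card {b \<in> boxes \<pi>. l \<in> content b}"

text \<open>The node representing a link in a switching, as a set of links: the whole box for a link
  of a box at depth zero, and a singleton for any other link.\<close>

definition collapse :: "('v, 'l, 'e) net \<Rightarrow> 'l \<Rightarrow> 'l set" where
  "collapse \<pi> l =
     insert l (\<Union>{box_links b | b. b \<in> boxes \<pi> \<and> depth \<pi> (principal b) = 0 \<and> l \<in> box_links b})"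

definition switching :: "('v, 'l, 'e) net \<Rightarrow> ('l \<Rightarrow> 'e) \<Rightarrow> bool" where
  "switching \<pi> \<sigma> \<longleftrightarrow>
     (\<forall>l\<in>links \<pi>. kind \<pi> l \<in> {Par_link, WhyNot_link} \<and> prems \<pi> l \<noteq> [] \<longrightarrow> \<sigma> l \<in> set (prems \<pi> l))"

definition switching_graph ::
  "('v, 'l, 'e) net \<Rightarrow> ('l \<Rightarrow> 'e) \<Rightarrow> ('l set, 'e \<times> direction) pre_digraph" where
  "switching_graph \<pi> \<sigma> =
     undirected (collapse \<pi> ` links \<pi>)
       {e \<in> edges \<pi> - conclusions \<pi>. depth \<pi> (source \<pi> e) = 0 \<and>
          (kind \<pi> (target \<pi> e) \<in> {Par_link, WhyNot_link} \<longrightarrow> e = \<sigma> (target \<pi> e))}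
       (\<lambda>e. collapse \<pi> (source \<pi> e))
       (\<lambda>e. collapse \<pi> (target \<pi> e))"

inductive DR_correct :: "('v, 'l, 'e) net \<Rightarrow> bool" where
  "(\<forall>\<sigma>. switching \<pi> \<sigma> \<longrightarrow> (\<nexists>c. undirected_cycle (switching_graph \<pi> \<sigma>) c)) \<Longrightarrow>
   (\<forall>b\<in>boxes \<pi>. DR_correct (content_net \<pi> b)) \<Longrightarrow>
   DR_correct \<pi>"

definition DR_net :: "('v, 'l, 'e) net \<Rightarrow> bool" where
  "DR_net \<pi> \<longleftrightarrow> is_net \<pi> \<and> DR_correct \<pi> \<and> (\<forall>e\<in>conclusions \<pi>. \<forall>A. label \<pi> e \<noteq> Flat A)"


section \<open>Exponential indexings and linear logic by levels\<close>

definition exponential_indexing :: "('v, 'l, 'e) net \<Rightarrow> ('e \<Rightarrow> int) \<Rightarrow> bool" where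
  "exponential_indexing \<pi> I \<longleftrightarrow>
     (\<forall>l\<in>links \<pi>.
        if kind \<pi> l \<in> {Paragraph_link, OfCourse_link, WhyNot_link}
        then \<forall>e\<in>set (prems \<pi> l). \<forall>e'\<in>set (concls \<pi> l). I e = I e' + 1
        else \<forall>e\<in>set (prems \<pi> l) \<union> set (concls \<pi> l).
             \<forall>e'\<in>set (prems \<pi> l) \<union> set (concls \<pi> l). I e = I e') \<and>
     (\<forall>e\<in>conclusions \<pi>. \<forall>e'\<in>conclusions \<pi>. I e = I e')"

definition L3 :: "('v, 'l, 'e) net set" where
  "L3 = {\<pi>. DR_net \<pi> \<and> (\<exists>I. exponential_indexing \<pi> I)}"


section \<open>Par-closure\<close>

definition add_par ::
  "'l \<Rightarrow> 'e \<Rightarrow> 'e \<Rightarrow> 'e \<Rightarrow> 'v fm \<Rightarrow> ('v, 'l, 'e) net \<Rightarrow> ('v, 'l, 'e) net" where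
  "add_par l a b e C \<pi> =
     \<pi>\<lparr>links := insert l (links \<pi>),
       kind := (kind \<pi>)(l := Par_link),
       prems := (prems \<pi>)(l := [a, b]),
       concls := (concls \<pi>)(l := [e]),
       label := (label \<pi>)(e := Formula C)\<rparr>"

text \<open>\<open>par_closure \<pi> \<pi>\<^sub>0\<close>: \<open>\<pi>\<^sub>0\<close> arises from \<open>\<pi>\<close> by adding par links below pairs of
  conclusions until at most one conclusion is left. The added links form a binary tree whose leaves
  are the conclusions of \<open>\<pi>\<close>, in any order and with any bracketing; a net without conclusions
  (such as a one cut against a bottom) is its own closure.\<close>

inductive par_closure :: "('v, 'l, 'e) net \<Rightarrow> ('v, 'l, 'e) net \<Rightarrow> bool" where
  base: "card (conclusions \<pi>) \<le> 1 \<Longrightarrow> par_closure \<pi> \<pi>"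
| step: "\<lbrakk>a \<in> conclusions \<pi>; b \<in> conclusions \<pi>; a \<noteq> b;
          label \<pi> a = Formula A; label \<pi> b = Formula B;
          l \<notin> links \<pi>; e \<notin> edges \<pi>;
          par_closure (add_par l a b e (Par A B) \<pi>) \<pi>\<^sub>0\<rbrakk>
         \<Longrightarrow> par_closure \<pi> \<pi>\<^sub>0"


text \<open>Closures exist as soon as fresh links and edges are available.\<close>

lemma conclusions_add_par:
  assumes "a \<in> conclusions \<pi>" "b \<in> conclusions \<pi>" "l \<notin> links \<pi>" "e \<notin> edges \<pi>"
    and "\<forall>l\<in>links \<pi>. set (prems \<pi> l) \<subseteq> edges \<pi>"
  shows "conclusions (add_par l a b e C \<pi>) = insert e (conclusions \<pi> - {a, b})"
    and "edges (add_par l a b e C \<pi>) = insert e (edges \<pi>)"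
proof -
  have *: "links (add_par l a b e C \<pi>) = insert l (links \<pi>)"
    "prems (add_par l a b e C \<pi>) = (prems \<pi>)(l := [a, b])"
    "concls (add_par l a b e C \<pi>) = (concls \<pi>)(l := [e])"
    by (simp_all add: add_par_def)
  have P: "(\<Union>x\<in>links \<pi>. set (((prems \<pi>)(l := [a, b])) x)) = (\<Union>x\<in>links \<pi>. set (prems \<pi> x))"
    and Q: "(\<Union>x\<in>links \<pi>. set (((concls \<pi>)(l := [e])) x)) = edges \<pi>"
    using assms(3) by (auto simp: edges_def split: if_splits)
  show E: "edges (add_par l a b e C \<pi>) = insert e (edges \<pi>)"
    unfolding edges_def[of "add_par l a b e C \<pi>"] * using Q by auto
  have ne: "e \<noteq> a" "e \<noteq> b" "e \<notin> (\<Union>x\<in>links \<pi>. set (prems \<pi> x))"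
    using assms by (auto simp: conclusions_def)
  show "conclusions (add_par l a b e C \<pi>) = insert e (conclusions \<pi> - {a, b})"
    unfolding conclusions_def E unfolding * using P ne by auto
qed

lemma par_closure_exists:
  fixes \<pi> :: "('v, 'l, 'e) net"
  assumes "infinite (UNIV :: 'l set)" "infinite (UNIV :: 'e set)" "DR_net \<pi>"
  shows "\<exists>\<pi>\<^sub>0. par_closure \<pi> \<pi>\<^sub>0"
proof -
  have "\<lbrakk>finite (links \<pi>); \<forall>l\<in>links \<pi>. set (prems \<pi> l) \<subseteq> edges \<pi>;
      \<forall>e\<in>conclusions \<pi>. \<forall>A. label \<pi> e \<noteq> Flat A\<rbrakk> \<Longrightarrow> ?thesis"
  proof (induction "card (conclusions \<pi>)" arbitrary: \<pi> rule: less_induct)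
    case less
    have fin: "finite (edges \<pi>)" "finite (conclusions \<pi>)"
      using less.prems(1) by (auto simp: edges_def conclusions_def)
    show ?case
    proof (cases "card (conclusions \<pi>) \<le> 1")
      case True
      then show ?thesis by (blast intro: par_closure.base)
    next
      case False
      then obtain a b where ab: "a \<in> conclusions \<pi>" "b \<in> conclusions \<pi>" "a \<noteq> b"
        using card_le_Suc0_iff_eq[OF fin(2)] by auto
      obtain A B where AB: "label \<pi> a = Formula A" "label \<pi> b = Formula B"
        using ab less.prems(3) by (metis edge_label.exhaust)
      obtain l e where fresh: "l \<notin> links \<pi>" "e \<notin> edges \<pi>"
        using assms(1,2) less.prems(1) fin(1) by (metis ex_new_if_finite)
      let ?\<pi> = "add_par l a b e (Par A B) \<pi>"
      note ca = conclusions_add_par[OF ab(1,2) fresh less.prems(2)]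
      have "card (conclusions ?\<pi>) \<le> Suc (card (conclusions \<pi> - {a, b}))"
        unfolding ca using fin(2) by (simp add: card_insert_if)
      also have "\<dots> < card (conclusions \<pi>)"
        using ab fin(2) False by (simp add: card_Diff_subset)
      finally have lt: "card (conclusions ?\<pi>) < card (conclusions \<pi>)" .
      have "\<exists>\<pi>\<^sub>0. par_closure ?\<pi> \<pi>\<^sub>0"
      proof (rule less.hyps[OF lt])
        show "finite (links ?\<pi>)" using less.prems(1) by (simp add: add_par_def)
        show "\<forall>l\<in>links ?\<pi>. set (prems ?\<pi> l) \<subseteq> edges ?\<pi>"
          unfolding ca using less.prems(2) ab by (auto simp: add_par_def conclusions_def)
        show "\<forall>e\<in>conclusions ?\<pi>. \<forall>A. label ?\<pi> e \<noteq> Flat A"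
          unfolding ca using less.prems(3) by (auto simp: add_par_def)
      qed
      then show ?thesis
        using ab AB fresh by (blast intro: par_closure.step)
    qed
  qed
  then show ?thesis
    using assms(3) by (simp add: DR_net_def is_net_def graph_wf_def)
qed


section \<open>Balanced cycles\<close>

definition underlying_graph :: "('v, 'l, 'e) net \<Rightarrow> ('l, 'e \<times> direction) pre_digraph" where
  "underlying_graph \<pi> =
     undirected (links \<pi>) (edges \<pi> - conclusions \<pi>) (source \<pi>) (target \<pi>)"

text \<open>The number of paragraph, of course and why not links which a cycle enters and leaves in
  direction \<open>d\<close>: entering and leaving a link downwards means going from one of its premises to its
  conclusion, doing so upwards means going from its conclusion to one of its premises. The pairs in
  \<open>zip c (rotate1 c)\<close> are the cyclically consecutive arcs.\<close>

definition modal_traversals ::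
  "('v, 'l, 'e) net \<Rightarrow> direction \<Rightarrow> ('e \<times> direction) list \<Rightarrow> nat" where
  "modal_traversals \<pi> d c =
     length (filter
       (\<lambda>(x, y). snd x = d \<and> snd y = d \<and>
          kind \<pi> (head (underlying_graph \<pi>) x) \<in> {Paragraph_link, OfCourse_link, WhyNot_link})
       (zip c (rotate1 c)))"

definition balanced :: "('v, 'l, 'e) net \<Rightarrow> ('e \<times> direction) list \<Rightarrow> bool" where
  "balanced \<pi> c \<longleftrightarrow> modal_traversals \<pi> Down c = modal_traversals \<pi> Up c"

end

theory Submission
  imports Defs
begin

text \<open>
  An exponential indexing assigns to each link an integer, the index of its conclusions; the
  premises then have that index, increased by one at paragraph, of course and why not links. It is
  therefore the same thing as a potential on the links whose drop along an edge is prescribed by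
  the kind of the target of that edge, and such a potential exists iff the drops sum to zero around
  every cycle. A cycle reaching a link through one premise and leaving it through another
  contributes two opposite terms, so the sum around a cycle is the difference between its upward
  and its downward traversals of modal links. Closing with par links turns the requirement that the
  conclusions have equal indices into a condition on cycles.
\<close>

section \<open>Potentials on undirected multigraphs\<close>

primrec signed :: "('e \<Rightarrow> 'a::ab_group_add) \<Rightarrow> 'e \<Rightarrow> direction \<Rightarrow> 'a" where
  "signed w e Down = w e"
| "signed w e Up = - w e"

definition weight :: "('e \<Rightarrow> 'a::ab_group_add) \<Rightarrow> ('e \<times> direction) list \<Rightarrow> 'a" where
  "weight w p = (\<Sum>(e, d)\<leftarrow>p. signed w e d)"

lemma weight_simps [simp]:
  "weight w [] = 0"
  "weight w (x # p) = signed w (fst x) (snd x) + weight w p"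
  "weight w (p @ q) = weight w p + weight w q"
  by (simp_all add: weight_def split_beta)

primrec opposite :: "direction \<Rightarrow> direction" where
  "opposite Down = Up"
| "opposite Up = Down"

lemma signed_opposite: "d \<noteq> d' \<Longrightarrow> signed w e d + signed w e d' = 0"
  by (cases d; cases d') simp_all

locale undirected_multigraph =
  fixes V :: "'n set" and E :: "'e set" and s t :: "'e \<Rightarrow> 'n"
  assumes ends_in_verts: "e \<in> E \<Longrightarrow> s e \<in> V" "e \<in> E \<Longrightarrow> t e \<in> V"
begin

abbreviation "G \<equiv> undirected V E s t"

lemma undirected_sel [simp]:
  "verts G = V"
  "arcs G = E \<times> UNIV"
  "tail G (e, Down) = s e" "tail G (e, Up) = t e"
  "head G (e, Down) = t e" "head G (e, Up) = s e"
  by (simp_all add: undirected_def)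

sublocale wf_digraph G
proof
  fix a assume "a \<in> arcs G"
  then show "tail G a \<in> verts G" "head G a \<in> verts G"
    by (cases a; cases "snd a"; auto simp: ends_in_verts)+
qed

section \<open>Walks and their weights\<close>

lemma ends_opposite:
  "tail G (e, opposite d) = head G (e, d)" "head G (e, opposite d) = tail G (e, d)"
  by (cases d; simp)+

text \<open>Traverse the opposite arcs in reverse order. Only existence is recorded, because return
  walks serve for connectivity and as a common tail whose weight cancels.\<close>

lemma awalk_reverse:
  assumes "awalk u p v"
  shows "\<exists>q. awalk v q u"
  using assms
proof (induction p arbitrary: u)
  case Nil
  then show ?case by (intro exI[of _ "[]"]) (auto simp: awalk_simps)
next
  case (Cons a p)
  obtain e d where a: "a = (e, d)" by force
  obtain q where "awalk v q (head G a)"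
    using Cons by (auto simp: awalk_Cons_iff)
  moreover have "awalk (head G a) [(e, opposite d)] u"
    using Cons.prems a awalk_hd_in_verts[OF Cons.prems]
    by (auto simp: awalk_simps ends_opposite)
  ultimately show ?case by (meson awalk_appendI)
qed

text \<open>Telescoping: an \<open>Up\<close> arc takes back exactly what the \<open>Down\<close>
  arc on the same edge adds.\<close>

lemma weight_awalk_potential:
  assumes "\<And>e. e \<in> E \<Longrightarrow> J (t e) = J (s e) + w e" and "awalk u p v"
  shows "J v = J u + weight w p"
  using assms(2)
proof (induction p arbitrary: u)
  case Nil
  then show ?case by (auto simp: awalk_simps)
next
  case (Cons a p)
  obtain e d where a: "a = (e, d)" by force
  show ?case
    using Cons assms(1)[of e] a by (cases d) (auto simp: awalk_Cons_iff algebra_simps)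
qed

text \<open>Strong induction on the length: a closed walk that is neither empty nor an undirected
  cycle splits into shorter closed walks, up to a pair of opposite arcs that cancel.\<close>

lemma weight_closed_awalk:
  assumes cyc: "\<And>c. undirected_cycle G c \<Longrightarrow> weight w c = 0" and "awalk u p u"
  shows "weight w p = 0"
  using assms(2)
proof (induction "length p" arbitrary: u p rule: less_induct)
  case less
  note IH = less.hyps and p = less.prems
  \<comment> \<open>A repeated edge is a case of its own: going back and forth along an edge with
    distinct ends is a \<open>cycle\<close> of the digraph but not an
    \<open>undirected_cycle\<close>.\<close>
  consider "p = []" | "undirected_cycle G p"
    | "p \<noteq> []" "\<not> distinct (tl (awalk_verts u p))" | "\<not> distinct (map fst p)"
    using p by (auto simp: undirected_cycle_def cycle_def)
  then show ?case
  proof cases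
    case 3
    \<comment> \<open>A closed walk lists \<open>u\<close> first and last, hence the
      \<open>tl\<close>. Without its first arc the repetition lies in the walk \<open>q\<close>,
      from which a nonempty closed part \<open>r\<close> can be cut out.\<close>
    then obtain a q where aq: "p = a # q" by (cases p) auto
    have q: "awalk (head G a) q u" "\<not> distinct (awalk_verts (head G a) q)"
      using p 3 aq by (auto simp: awalk_Cons_iff)
    obtain q1 r q2 v where dec: "q = q1 @ r @ q2" "0 < length r"
      "awalk (head G a) q1 v" "awalk v r v" "awalk v q2 u"
      using awalk_not_distinct_decomp[OF q] by blast
    have "weight w r = 0"
      using dec aq by (intro IH[of r v]) auto
    moreover have "awalk u (a # q1 @ q2) u"
      using p dec aq by (auto simp: awalk_Cons_iff)
    then have "weight w (a # q1 @ q2) = 0"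
      using dec aq by (intro IH) auto
    ultimately show ?thesis using aq dec by simp
  next
    case 4
    then obtain xs ys zs e where "map fst p = xs @ [e] @ ys @ [e] @ zs"
      using not_distinct_decomp by blast
    then obtain p1 x p2 y p3 where dec: "p = p1 @ x # p2 @ y # p3" and xy: "fst x = fst y"
      by (auto simp: map_eq_append_conv map_eq_Cons_conv append_eq_map_conv Cons_eq_map_conv)
    have walks: "awalk u p1 (tail G x)" "awalk (tail G x) [x] (head G x)"
      "awalk (head G x) p2 (tail G y)" "awalk (tail G y) [y] (head G y)" "awalk (head G y) p3 u"
      using p unfolding dec by (auto simp: awalk_simps)
    show ?thesis
    proof (cases "x = y")
      case True
      \<comment> \<open>The same arc twice: the stretch from its first occurrence up to the second
        is closed, and so is what remains.\<close>
      have "awalk (tail G x) (x # p2) (tail G x)" "awalk u (p1 @ y # p3) u"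
        using walks True by (auto simp: awalk_Cons_iff)
      then have "weight w (x # p2) = 0" "weight w (p1 @ y # p3) = 0"
        using dec by (auto intro!: IH simp del: weight_simps)
      moreover have "weight w p = weight w (x # p2) + weight w (p1 @ y # p3)"
        by (simp add: dec ac_simps)
      ultimately show ?thesis by simp
    next
      case False
      \<comment> \<open>Opposite arcs on one edge: deleting both leaves the closed walks
        \<open>p2\<close> and \<open>p1 @ p3\<close>, and the deleted weights cancel.\<close>
      then have opp: "snd x \<noteq> snd y" using xy by (simp add: prod_eq_iff)
      then have "tail G y = head G x" "head G y = tail G x"
        using xy by (cases x; cases y; cases "snd x"; cases "snd y"; simp)+
      then have "awalk (head G x) p2 (head G x)" "awalk u (p1 @ p3) u"
        using walks by auto
      then have "weight w p2 = 0" "weight w (p1 @ p3) = 0"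
        using dec by (auto intro!: IH simp del: weight_simps)
      moreover have "weight w p = weight w p2 + weight w (p1 @ p3) +
          (signed w (fst y) (snd x) + signed w (fst y) (snd y))"
        by (simp add: dec xy ac_simps)
      ultimately show ?thesis using signed_opposite[OF opp, of w "fst y"] by simp
    qed
  qed (use cyc in auto)
qed

text \<open>Path independence, as for conservative vector fields: if all cycles are weightless, the
  weight of a walk depends only on its ends, and measuring it from a chosen root of each component
  gives a potential.\<close>

theorem potential_iff_cycles_weightless:
  "(\<exists>J. \<forall>e\<in>E. J (t e) = J (s e) + w e) \<longleftrightarrow> (\<forall>c. undirected_cycle G c \<longrightarrow> weight w c = 0)"
proof (intro iffI allI impI)
  fix c assume "\<exists>J. \<forall>e\<in>E. J (t e) = J (s e) + w e" "undirected_cycle G c"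
  then obtain J u where "\<And>e. e \<in> E \<Longrightarrow> J (t e) = J (s e) + w e" "awalk u c u"
    by (auto simp: undirected_cycle_def cycle_def)
  then have "J u = J u + weight w c" by (rule weight_awalk_potential)
  then show "weight w c = 0" by simp
next
  assume "\<forall>c. undirected_cycle G c \<longrightarrow> weight w c = 0"
  then have closed: "weight w p = 0" if "awalk u p u" for u p
    using weight_closed_awalk that by blast
  \<comment> \<open>The choice depends on \<open>v\<close> only through the set of vertices from
    which \<open>v\<close> is reachable, so all vertices of a component share their root.\<close>
  define root where "root v = (SOME u. \<exists>p. awalk u p v)" for v
  define path where "path v = (SOME p. awalk (root v) p v)" for v
  have path: "awalk (root v) (path v) v" if "v \<in> V" for v
  proof -
    have "\<exists>u p. awalk u p v" using that by (metis awalk_Nil_iff undirected_sel(1))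
    then have "\<exists>p. awalk (root v) p v" unfolding root_def by (rule someI_ex)
    then show ?thesis unfolding path_def by (rule someI_ex)
  qed
  have "weight w (path (t e)) = weight w (path (s e)) + w e" if e: "e \<in> E" for e
  proof -
    have arc: "awalk (s e) [(e, Down)] (t e)"
      using e by (auto simp: awalk_simps ends_in_verts)
    then obtain r where r: "awalk (t e) r (s e)"
      using awalk_reverse by blast
    have "(\<exists>p. awalk u p (s e)) \<longleftrightarrow> (\<exists>p. awalk u p (t e))" for u
      using arc r by (meson awalk_appendI)
    then have root: "root (t e) = root (s e)" by (simp add: root_def)
    have ps: "awalk (root (s e)) (path (s e)) (s e)" and pt: "awalk (root (s e)) (path (t e)) (t e)"
      using path[of "s e"] path[of "t e"] e root by (auto simp: ends_in_verts)
    \<comment> \<open>The same return walk \<open>q\<close> closes the chosen path to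
      \<open>t e\<close> and the detour through \<open>s e\<close> and \<open>e\<close>; both closed
      walks are weightless and the weight of \<open>q\<close> cancels.\<close>
    obtain q where q: "awalk (t e) q (root (s e))"
      using awalk_reverse[OF pt] by blast
    have "weight w (path (t e) @ q) = 0"
      using pt q by (intro closed[of "root (s e)"] awalk_appendI)
    moreover have "weight w (path (s e) @ [(e, Down)] @ q) = 0"
      using ps arc q by (intro closed[of "root (s e)"] awalk_appendI)
    ultimately have "weight w (path (t e)) + weight w q = weight w (path (s e)) + w e + weight w q"
      by (simp add: add.assoc)
    then show ?thesis by simp
  qed
  then show "\<exists>J. \<forall>e\<in>E. J (t e) = J (s e) + w e"
    by (intro exI[of _ "\<lambda>v. weight w (path v)"]) blast
qed

end

text \<open>\<open>z\<close> generalises the first arc of the cycle: for \<open>z = x\<close> the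
  zip pairs each arc with its cyclic successor, while in the induction \<open>z\<close> stays fixed
  as \<open>x\<close> advances.\<close>

lemma cas_consecutive:
  assumes "pre_digraph.cas H u (x # p) (tail H z)" "(a, b) \<in> set (zip (x # p) (p @ [z]))"
  shows "head H a = tail H b"
  using assms
proof (induction p arbitrary: u x)
  case Nil
  then show ?case by (simp add: pre_digraph.cas.simps)
next
  case (Cons y p)
  have walk: "pre_digraph.cas H (head H x) (y # p) (tail H z)"
    using Cons.prems(1) by (simp add: pre_digraph.cas.simps)
  from Cons.prems(2) consider "a = x" "b = y" | "(a, b) \<in> set (zip (y # p) (p @ [z]))"
    by auto
  then show ?case
  proof cases
    case 1
    then show ?thesis using walk by (simp add: pre_digraph.cas.simps)
  qed (rule Cons.IH[OF walk])
qed

lemma cycle_consecutive: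
  assumes "pre_digraph.cycle H c" "(x, y) \<in> set (zip c (rotate1 c))"
  shows "head H x = tail H y"
proof -
  obtain u where u: "pre_digraph.cas H u c u" "c \<noteq> []"
    using assms(1) by (auto simp: pre_digraph.cycle_def pre_digraph.awalk_def)
  then obtain a q where c: "c = a # q" by (cases c) auto
  then have "tail H a = u" using u by (simp add: pre_digraph.cas.simps)
  then show ?thesis using cas_consecutive[of H u a q a x y] u(1) assms(2) c by simp
qed

section \<open>Indexings as potentials\<close>

definition modal :: "link_kind \<Rightarrow> bool" where
  "modal k \<longleftrightarrow> k \<in> {Paragraph_link, OfCourse_link, WhyNot_link}"

text \<open>For a modal link \<open>exponential_indexing\<close> relates premises only to
  conclusions, so a unique conclusion is what gives the link a well-defined level.\<close>

lemma modal_link_typing: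
  assumes "link_typing k \<Gamma> \<Delta>" "modal k"
  shows "length \<Delta> = 1"
  using assms by cases (auto simp: modal_def)

context
  fixes \<pi> :: "('v, 'l, 'e) net"
  assumes wf: "graph_wf \<pi>"
begin

lemma source_eq: "l \<in> links \<pi> \<Longrightarrow> e \<in> set (concls \<pi> l) \<Longrightarrow> source \<pi> e = l"
  using wf unfolding source_def graph_wf_def by (intro the_equality) blast+

lemma target_eq: "l \<in> links \<pi> \<Longrightarrow> e \<in> set (prems \<pi> l) \<Longrightarrow> target \<pi> e = l"
  using wf unfolding target_def graph_wf_def by (intro the_equality) blast+

lemma source_concls:
  "e \<in> edges \<pi> \<Longrightarrow> source \<pi> e \<in> links \<pi> \<and> e \<in> set (concls \<pi> (source \<pi> e))"
  using source_eq by (auto simp: edges_def)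

lemma target_prems:
  "e \<in> edges \<pi> - conclusions \<pi> \<Longrightarrow> target \<pi> e \<in> links \<pi> \<and> e \<in> set (prems \<pi> (target \<pi> e))"
  using target_eq by (auto simp: conclusions_def)

lemma prems_internal: "l \<in> links \<pi> \<Longrightarrow> set (prems \<pi> l) \<subseteq> edges \<pi> - conclusions \<pi>"
  using wf by (auto simp: graph_wf_def conclusions_def)

lemma finite_conclusions: "finite (conclusions \<pi>)"
  using wf by (auto simp: graph_wf_def conclusions_def edges_def)

lemma modal_concls:
  assumes "l \<in> links \<pi>" "modal (kind \<pi> l)"
  obtains e where "concls \<pi> l = [e]"
proof -
  have "length (map (label \<pi>) (concls \<pi> l)) = 1"
    using wf assms by (intro modal_link_typing) (auto simp: graph_wf_def)
  then show ?thesis using that by (auto simp: length_Suc_conv)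
qed

text \<open>The index of an edge is the potential of its source; a modal target lies one below that
  index, hence the minus sign.\<close>

definition drop_along :: "'e \<Rightarrow> int" where
  "drop_along e = - of_bool (modal (kind \<pi> (target \<pi> e)))"

text \<open>With at most one conclusion, the demand for equal indices at the conclusions is trivial;
  what remains is local to the links and can be read edge by edge.\<close>

lemma exponential_indexing_iff_potential:
  assumes "card (conclusions \<pi>) \<le> 1"
  shows "(\<exists>I. exponential_indexing \<pi> I) \<longleftrightarrow>
    (\<exists>J. \<forall>e\<in>edges \<pi> - conclusions \<pi>. J (target \<pi> e) = J (source \<pi> e) + drop_along e)"
proof
  assume "\<exists>I. exponential_indexing \<pi> I"
  then obtain I where I: "exponential_indexing \<pi> I" ..
  \<comment> \<open>Only a cut has no conclusion; its potential is the common index of its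
    premises.\<close>
  define J where "J l = (if concls \<pi> l = [] then I (hd (prems \<pi> l)) else I (hd (concls \<pi> l)))" for l
  note at_link = I[unfolded exponential_indexing_def modal_def[symmetric], THEN conjunct1, THEN bspec]
  have shift: "I e = I e' + 1"
    if "l \<in> links \<pi>" "modal (kind \<pi> l)" "e \<in> set (prems \<pi> l)" "e' \<in> set (concls \<pi> l)" for l e e'
    using at_link[OF that(1), unfolded if_P[OF that(2)]] that(3,4) by blast
  have const: "I e = I e'"
    if "l \<in> links \<pi>" "\<not> modal (kind \<pi> l)" "e \<in> set (prems \<pi> l) \<union> set (concls \<pi> l)"
      "e' \<in> set (prems \<pi> l) \<union> set (concls \<pi> l)" for l e e'
    using at_link[OF that(1), unfolded if_not_P[OF that(2)]] that(3,4) by blast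
  have src: "I e = J l" if l: "l \<in> links \<pi>" "e \<in> set (concls \<pi> l)" for l e
  proof (cases "modal (kind \<pi> l)")
    case True
    then obtain e' where "concls \<pi> l = [e']" using modal_concls[OF l(1)] by blast
    then show ?thesis using l(2) by (simp add: J_def)
  next
    case False
    moreover have "hd (concls \<pi> l) \<in> set (concls \<pi> l)" "concls \<pi> l \<noteq> []"
      using l(2) by (cases "concls \<pi> l"; simp)+
    ultimately show ?thesis
      using const[OF l(1), of e "hd (concls \<pi> l)"] l(2) by (simp add: J_def)
  qed
  have tgt: "I e = J l + of_bool (modal (kind \<pi> l))"
    if l: "l \<in> links \<pi>" "e \<in> set (prems \<pi> l)" for l e
  proof (cases "modal (kind \<pi> l)")
    case True
    then obtain e' where "concls \<pi> l = [e']" using modal_concls[OF l(1)] by blast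
    then show ?thesis using shift[OF l(1) True l(2), of e'] True by (simp add: J_def)
  next
    case False
    have "hd (prems \<pi> l) \<in> set (prems \<pi> l)" using l(2) by (cases "prems \<pi> l") auto
    then show ?thesis
      using const[OF l(1) False, of e "hd (prems \<pi> l)"] const[OF l(1) False, of e "hd (concls \<pi> l)"]
        l(2) False
      by (simp add: J_def)
  qed
  have "J (target \<pi> e) = J (source \<pi> e) + drop_along e" if e: "e \<in> edges \<pi> - conclusions \<pi>" for e
    using src[of "source \<pi> e" e] tgt[of "target \<pi> e" e] source_concls[of e] target_prems[OF e] e
    by (simp add: drop_along_def)
  then show "\<exists>J. \<forall>e\<in>edges \<pi> - conclusions \<pi>. J (target \<pi> e) = J (source \<pi> e) + drop_along e"
    by blast
next
  assume "\<exists>J. \<forall>e\<in>edges \<pi> - conclusions \<pi>. J (target \<pi> e) = J (source \<pi> e) + drop_along e"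
  then obtain J where
    "\<And>e. e \<in> edges \<pi> - conclusions \<pi> \<Longrightarrow> J (target \<pi> e) = J (source \<pi> e) + drop_along e"
    by blast
  then have J: "J (source \<pi> e) = J (target \<pi> e) + of_bool (modal (kind \<pi> (target \<pi> e)))"
    if "e \<in> edges \<pi> - conclusions \<pi>" for e
    using that by (simp add: drop_along_def)
  \<comment> \<open>Every edge has a source, whereas a conclusion of the net has no target; hence
    the index is read at the source.\<close>
  define I where "I e = J (source \<pi> e)" for e
  have concl: "I e = J l" if "l \<in> links \<pi>" "e \<in> set (concls \<pi> l)" for l e
    using source_eq[OF that] by (simp add: I_def)
  have prem: "I e = J l + of_bool (modal (kind \<pi> l))"
    if "l \<in> links \<pi>" "e \<in> set (prems \<pi> l)" for l e
    using J[of e] target_eq[OF that] prems_internal[OF that(1)] that(2) by (auto simp: I_def)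
  have "exponential_indexing \<pi> I"
    unfolding exponential_indexing_def modal_def[symmetric]
  proof (intro conjI ballI)
    fix l assume "l \<in> links \<pi>"
    from concl[OF this] prem[OF this]
    show "if modal (kind \<pi> l) then \<forall>e\<in>set (prems \<pi> l). \<forall>e'\<in>set (concls \<pi> l). I e = I e' + 1
      else \<forall>e\<in>set (prems \<pi> l) \<union> set (concls \<pi> l).
        \<forall>e'\<in>set (prems \<pi> l) \<union> set (concls \<pi> l). I e = I e'"
      by auto
  next
    fix e e' assume "e \<in> conclusions \<pi>" "e' \<in> conclusions \<pi>"
    then have "e = e'"
      using assms card_le_Suc0_iff_eq[OF finite_conclusions] by simp
    then show "I e = I e'" by simp
  qed
  then show "\<exists>I. exponential_indexing \<pi> I" by blast
qed

section \<open>Cycle weights and modal traversals\<close>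

lemma undirected_multigraph_net:
  "undirected_multigraph (links \<pi>) (edges \<pi> - conclusions \<pi>) (source \<pi>) (target \<pi>)"
  by standard (use source_concls target_prems in auto)

text \<open>Regroup the weight by visits to links. A modal link counts -1 when reached
  \<open>Down\<close> and +1 when left \<open>Up\<close>, so visits from premise to premise or from
  conclusion to conclusion contribute 0 and only genuine traversals survive.\<close>

lemma weight_cycle:
  assumes "pre_digraph.cycle (underlying_graph \<pi>) c"
  shows "weight drop_along c = int (modal_traversals \<pi> Up c) - int (modal_traversals \<pi> Down c)"
proof -
  define H where "H = underlying_graph \<pi>"
  define m :: "'l \<Rightarrow> int" where "m l = of_bool (modal (kind \<pi> l))" for l
  \<comment> \<open>The link that decides the drop is the target of the edge: the head of a
    \<open>Down\<close> arc, the tail of an \<open>Up\<close> arc.\<close>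
  define dn where "dn x = (if snd x = Down then m (head H x) else 0)" for x
  define up where "up x = (if snd x = Up then m (tail H x) else 0)" for x
  let ?z = "zip c (rotate1 c)"
  define traversed where "traversed d z \<longleftrightarrow>
    snd (fst z) = d \<and> snd (snd z) = d \<and> modal (kind \<pi> (head H (fst z)))"
    for d and z :: "('e \<times> direction) \<times> ('e \<times> direction)"
  have "int (length (filter P xs)) = (\<Sum>x\<leftarrow>xs. of_bool (P x))"
    for P and xs :: "(('e \<times> direction) \<times> ('e \<times> direction)) list"
    by (induction xs) simp_all
  moreover have "modal_traversals \<pi> d c = length (filter (traversed d) ?z)" for d
    unfolding modal_traversals_def traversed_def modal_def H_def
    by (rule arg_cong[of _ _ length], rule filter_cong) auto
  ultimately have traversals: "int (modal_traversals \<pi> d c) = (\<Sum>z\<leftarrow>?z. of_bool (traversed d z))" for d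
    by simp
  have "signed drop_along (fst x) (snd x) = up x - dn x" for x
    by (cases x; cases "snd x")
      (auto simp: drop_along_def up_def dn_def m_def H_def underlying_graph_def undirected_def)
  then have "weight drop_along c = (\<Sum>x\<leftarrow>c. up x) - (\<Sum>x\<leftarrow>c. dn x)"
    by (induction c) simp_all
  \<comment> \<open>\<open>map snd ?z\<close> is \<open>rotate1 c\<close>, and rotation keeps the
    sum; now each pair couples the arc reaching a link with the arc leaving it.\<close>
  also have "(\<Sum>x\<leftarrow>c. up x) = (\<Sum>x\<leftarrow>map snd ?z. up x)"
    by (cases c) (simp_all add: add.commute)
  also have "(\<Sum>x\<leftarrow>c. dn x) = (\<Sum>x\<leftarrow>map fst ?z. dn x)"
    by simp
  also have "(\<Sum>x\<leftarrow>map snd ?z. up x) - (\<Sum>x\<leftarrow>map fst ?z. dn x) = (\<Sum>z\<leftarrow>?z. up (snd z) - dn (fst z))"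
    by (simp only: map_map comp_def sum_list_subtractf)
  also have "\<dots> = (\<Sum>z\<leftarrow>?z. of_bool (traversed Up z) - of_bool (traversed Down z))"
  proof (rule arg_cong[of _ _ sum_list], rule map_cong[OF refl])
    fix z assume "z \<in> set ?z"
    then have "head H (fst z) = tail H (snd z)"
      using cycle_consecutive[of H c "fst z" "snd z"] assms H_def by simp
    then show "up (snd z) - dn (fst z) = of_bool (traversed Up z) - of_bool (traversed Down z)"
      by (cases "snd (fst z)"; cases "snd (snd z)") (simp_all add: up_def dn_def m_def traversed_def)
  qed
  also have "\<dots> = int (modal_traversals \<pi> Up c) - int (modal_traversals \<pi> Down c)"
    by (simp add: traversals sum_list_subtractf)
  finally show ?thesis .
qed

lemma exponential_indexing_iff_balanced:
  assumes "card (conclusions \<pi>) \<le> 1"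
  shows "(\<exists>I. exponential_indexing \<pi> I) \<longleftrightarrow>
    (\<forall>c. undirected_cycle (underlying_graph \<pi>) c \<longrightarrow> balanced \<pi> c)"
proof -
  have "balanced \<pi> c \<longleftrightarrow> weight drop_along c = 0" if "undirected_cycle (underlying_graph \<pi>) c" for c
    using weight_cycle[of c] that by (auto simp: undirected_cycle_def balanced_def)
  then show ?thesis
    using exponential_indexing_iff_potential[OF assms]
      undirected_multigraph.potential_iff_cycles_weightless[OF undirected_multigraph_net,
        where w = drop_along]
    by (auto simp: underlying_graph_def)
qed

end

section \<open>Par-closure\<close>

text \<open>\<open>a\<close> and \<open>b\<close> are premises of no old link, and freshness of
  \<open>l\<close> and \<open>e\<close> leaves the old links and labels untouched.\<close>

lemma graph_wf_add_par:
  assumes wf: "graph_wf \<pi>"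
    and ab: "a \<in> conclusions \<pi>" "b \<in> conclusions \<pi>" "a \<noteq> b"
    and lab: "label \<pi> a = Formula A" "label \<pi> b = Formula B"
    and fresh: "l \<notin> links \<pi>" "e \<notin> edges \<pi>"
  shows "graph_wf (add_par l a b e (Par A B) \<pi>)"
proof -
  let ?\<pi> = "add_par l a b e (Par A B) \<pi>"
  have sub: "\<forall>k\<in>links \<pi>. set (prems \<pi> k) \<subseteq> edges \<pi>"
    using wf by (auto simp: graph_wf_def)
  note E = conclusions_add_par(2)[OF ab(1,2) fresh sub, of "Par A B"]
  have ne: "a \<noteq> e" "b \<noteq> e" "a \<in> edges \<pi>" "b \<in> edges \<pi>"
    using ab fresh by (auto simp: conclusions_def)
  have sel: "links ?\<pi> = insert l (links \<pi>)" "kind ?\<pi> l = Par_link" "prems ?\<pi> l = [a, b]"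
    "concls ?\<pi> l = [e]" "label ?\<pi> e = Formula (Par A B)"
    by (simp_all add: add_par_def)
  have old: "kind ?\<pi> k = kind \<pi> k" "prems ?\<pi> k = prems \<pi> k" "concls ?\<pi> k = concls \<pi> k"
    if "k \<in> links \<pi>" for k
    using that fresh by (auto simp: add_par_def)
  have old_label: "label ?\<pi> x = label \<pi> x" if "x \<in> edges \<pi>" for x
    using that fresh by (auto simp: add_par_def)
  have concls_sub: "set (concls \<pi> k) \<subseteq> edges \<pi>" if "k \<in> links \<pi>" for k
    using that by (auto simp: edges_def)
  have labels: "map (label ?\<pi>) (prems \<pi> k) = map (label \<pi>) (prems \<pi> k)"
    "map (label ?\<pi>) (concls \<pi> k) = map (label \<pi>) (concls \<pi> k)" if "k \<in> links \<pi>" for k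
    using bspec[OF sub that] concls_sub[OF that] by (auto intro!: old_label)
  have disj: "a \<notin> set (prems \<pi> k)" "b \<notin> set (prems \<pi> k)" "e \<notin> set (concls \<pi> k)"
    if "k \<in> links \<pi>" for k
    using that ab concls_sub[OF that] fresh by (auto simp: conclusions_def)
  have old_disj: "set (prems \<pi> k) \<inter> set (prems \<pi> k') = {}"
    "set (concls \<pi> k) \<inter> set (concls \<pi> k') = {}"
    if "k \<in> links \<pi>" "k' \<in> links \<pi>" "k \<noteq> k'" for k k'
    using wf that by (simp_all add: graph_wf_def)
  show ?thesis
    unfolding graph_wf_def E sel(1)
  proof (intro conjI ballI impI)
    show "finite (insert l (links \<pi>))" using wf by (simp add: graph_wf_def)
  next
    fix k assume "k \<in> insert l (links \<pi>)"
    then consider "k = l" | "k \<in> links \<pi>" by blast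
    note k = this
    show "link_typing (kind ?\<pi> k) (map (label ?\<pi>) (prems ?\<pi> k)) (map (label ?\<pi>) (concls ?\<pi> k))"
      using k
    proof cases
      case 1
      then show ?thesis
        using ne lab link_typing.intros(6)[of A B] by (simp add: sel old_label)
    next
      case 2
      then show ?thesis using wf by (simp add: old labels graph_wf_def)
    qed
    show "distinct (prems ?\<pi> k)" "distinct (concls ?\<pi> k)"
      using k wf ab by (cases; simp add: sel old graph_wf_def)+
    show "set (prems ?\<pi> k) \<subseteq> insert e (edges \<pi>)"
      using k sub ne by cases (auto simp: sel old)
  next
    fix k k' assume k: "k \<in> insert l (links \<pi>)" "k' \<in> insert l (links \<pi>)" "k \<noteq> k'"
    then consider "k = l" "k' \<in> links \<pi>" | "k' = l" "k \<in> links \<pi>" | "k \<in> links \<pi>" "k' \<in> links \<pi>"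
      by blast
    note kk = this
    show "set (prems ?\<pi> k) \<inter> set (prems ?\<pi> k') = {}"
      using kk disj(1,2) old_disj[OF _ _ k(3)] by cases (simp_all add: sel old)
    show "set (concls ?\<pi> k) \<inter> set (concls ?\<pi> k') = {}"
      using kk disj(3) old_disj[OF _ _ k(3)] by cases (simp_all add: sel old)
  qed
qed

text \<open>Allows an indexing to be changed at an edge that is fresh for the net.\<close>

lemma exponential_indexing_cong:
  assumes "\<And>l. l \<in> links \<pi> \<Longrightarrow> set (prems \<pi> l) \<subseteq> edges \<pi>"
    and "\<And>e. e \<in> edges \<pi> \<Longrightarrow> I e = I' e"
  shows "exponential_indexing \<pi> I \<longleftrightarrow> exponential_indexing \<pi> I'"
proof -
  have "I e = I' e" if "l \<in> links \<pi>" "e \<in> set (prems \<pi> l) \<union> set (concls \<pi> l)" for l e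
    using that assms by (fastforce simp: edges_def)
  moreover have "I e = I' e" if "e \<in> conclusions \<pi>" for e
    using that assms by (auto simp: conclusions_def)
  ultimately show ?thesis
    unfolding exponential_indexing_def
    by (intro arg_cong2[of _ _ _ _ "(\<and>)"] ball_cong refl if_cong) auto
qed

text \<open>The new par link forces one index on \<open>a\<close>, \<open>b\<close> and
  \<open>e\<close>, and \<open>e\<close> then stands in for both among the conclusions.\<close>

lemma exponential_indexing_add_par:
  assumes sub: "\<forall>k\<in>links \<pi>. set (prems \<pi> k) \<subseteq> edges \<pi>"
    and ab: "a \<in> conclusions \<pi>" "b \<in> conclusions \<pi>"
    and fresh: "l \<notin> links \<pi>" "e \<notin> edges \<pi>"
  shows "exponential_indexing (add_par l a b e C \<pi>) I \<longleftrightarrow> exponential_indexing \<pi> I \<and> I e = I a"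
proof -
  note C = conclusions_add_par(1)[OF ab fresh sub, of C]
  have links: "(\<forall>k\<in>links (add_par l a b e C \<pi>). P (kind (add_par l a b e C \<pi>) k)
        (set (prems (add_par l a b e C \<pi>) k)) (set (concls (add_par l a b e C \<pi>) k))) \<longleftrightarrow>
      P Par_link {a, b} {e} \<and> (\<forall>k\<in>links \<pi>. P (kind \<pi> k) (set (prems \<pi> k)) (set (concls \<pi> k)))"
    for P
    using fresh(1) by (auto simp: add_par_def)
  have par: "(if Par_link \<in> {Paragraph_link, OfCourse_link, WhyNot_link}
      then \<forall>x\<in>{a, b}. \<forall>y\<in>{e}. I x = I y + 1
      else \<forall>x\<in>{a, b} \<union> {e}. \<forall>y\<in>{a, b} \<union> {e}. I x = I y) \<longleftrightarrow> I a = I e \<and> I b = I e"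
    by auto
  have concl: "(I a = I e \<and> I b = I e) \<and>
      (\<forall>x\<in>insert e (conclusions \<pi> - {a, b}). \<forall>y\<in>insert e (conclusions \<pi> - {a, b}). I x = I y) \<longleftrightarrow>
      (\<forall>x\<in>conclusions \<pi>. \<forall>y\<in>conclusions \<pi>. I x = I y) \<and> I e = I a" (is "?L \<longleftrightarrow> ?R")
  proof
    assume ?L
    then have "I a = I e" "I b = I e" and "\<And>x. x \<in> conclusions \<pi> - {a, b} \<Longrightarrow> I x = I e"
      by blast+
    then have "I x = I e" if "x \<in> conclusions \<pi>" for x
      using that by (cases "x \<in> {a, b}") auto
    then show ?R using ab by simp
  next
    assume ?R
    then have "I x = I e" if "x \<in> conclusions \<pi>" for x
      using that ab by metis
    then show ?L using ab by simp
  qed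
  \<comment> \<open>The condition at the old links is the same on both sides; \<open>concl\<close>
    settles the rest.\<close>
  have rearrange: "(P \<and> L) \<and> C' \<longleftrightarrow> (L \<and> C) \<and> Q" if "P \<and> C' \<longleftrightarrow> C \<and> Q" for P L C' C Q
    using that by blast
  show ?thesis
    unfolding exponential_indexing_def C
      links[of "\<lambda>k ps cs. if k \<in> {Paragraph_link, OfCourse_link, WhyNot_link}
        then \<forall>e\<in>ps. \<forall>e'\<in>cs. I e = I e' + 1 else \<forall>e\<in>ps \<union> cs. \<forall>e'\<in>ps \<union> cs. I e = I e'"]
      par
    by (rule rearrange[OF concl])
qed

text \<open>Each added par link preserves the existence of an indexing, and the process stops at a
  net to which the criterion by potentials applies.\<close>

lemma par_closure_indexing:
  assumes "par_closure \<pi> \<pi>\<^sub>0" "graph_wf \<pi>"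
  shows "graph_wf \<pi>\<^sub>0 \<and> card (conclusions \<pi>\<^sub>0) \<le> 1 \<and>
    ((\<exists>I. exponential_indexing \<pi> I) \<longleftrightarrow> (\<exists>I. exponential_indexing \<pi>\<^sub>0 I))"
  using assms
proof induction
  case (base \<pi>)
  then show ?case by blast
next
  case (step a \<pi> b A B l e \<pi>\<^sub>0)
  let ?\<pi> = "add_par l a b e (Par A B) \<pi>"
  have wf: "graph_wf ?\<pi>"
    using step by (intro graph_wf_add_par) auto
  have sub: "\<forall>k\<in>links \<pi>. set (prems \<pi> k) \<subseteq> edges \<pi>"
    using step.prems by (auto simp: graph_wf_def)
  note iff = exponential_indexing_add_par[OF sub step.hyps(1,2,6,7), of "Par A B"]
  have "a \<noteq> e" using step.hyps by (auto simp: conclusions_def)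
  \<comment> \<open>Since \<open>e\<close> is no edge of \<open>\<pi>\<close>, the value
    \<open>I e\<close> is arbitrary; it is reset to the index that the par link demands.\<close>
  have "exponential_indexing ?\<pi> (I(e := I a))" if I: "exponential_indexing \<pi> I" for I
  proof -
    have "exponential_indexing \<pi> (I(e := I a)) \<longleftrightarrow> exponential_indexing \<pi> I"
      by (rule exponential_indexing_cong) (use sub step.hyps(7) in auto)
    then show ?thesis using I \<open>a \<noteq> e\<close> by (simp add: iff)
  qed
  then have "(\<exists>I. exponential_indexing \<pi> I) \<longleftrightarrow> (\<exists>I. exponential_indexing ?\<pi> I)"
    using iff by blast
  then show ?case using step.IH[OF wf] by blast
qed

theorem mainTheorem12:
  fixes \<pi> \<pi>\<^sub>0 :: "('v, 'l, 'e) net"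
  assumes "DR_net \<pi>"
    and "par_closure \<pi> \<pi>\<^sub>0"
  shows "\<pi> \<in> L3 \<longleftrightarrow>
    (\<forall>c. undirected_cycle (underlying_graph \<pi>\<^sub>0) c \<longrightarrow> balanced \<pi>\<^sub>0 c)"
proof -
  have "graph_wf \<pi>" using assms(1) by (simp add: DR_net_def is_net_def)
  note closure = par_closure_indexing[OF assms(2) this]
  have "\<pi> \<in> L3 \<longleftrightarrow> (\<exists>I. exponential_indexing \<pi>\<^sub>0 I)"
    using assms(1) closure by (simp add: L3_def)
  then show ?thesis
    using exponential_indexing_iff_balanced[of \<pi>\<^sub>0] closure by simp
qed

end
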